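(* Let $f:\mathbb{Z}^n\to\mathbb{R}\cup\{+\infty\}$ be a globally discrete midpoint convex function. (1) For any $z\in\mathbb{Z}^n$, the function $x\mapsto f(z+x)$ is globally discrete midpoint convex. (2) For any permutation $\sigma$ of $(1,2,\ldots,n)$, the function $x\mapsto f(x_{\sigma(1)},x_{\sigma(2)},\ldots,x_{\sigma(n)})$ is globally discrete midpoint convex. (3) The function $x\mapsto f(-x_1,-x_2,\ldots,-x_n)$ is globally discrete midpoint convex. (4) For any real numbers $a_1,a_2\ge0$ and any globally discrete midpoint convex functions $f_1,f_2:\mathbb{Z}^n\to\mathbb{R}\cup\{+\infty\}$, the function $g=a_1f_1+a_2f_2$ is globally discrete midpoint convex. That is, the class of globally discrete midpoint convex functions forms a convex cone.
   Context: For $x\in\mathbb{R}^n$, $\lceil x\rceil$ and $\lfloor x\rfloor$ denote the integer vectors obtained by rounding each component up, respectively down. A function $f:\mathbb{Z}^n\to\mathbb{R}\cup\{+\infty\}$ is globally discrete midpoint convex if $$f(x)+f(y)\ge f(\lceil (x+y)/2\rceil)+f(\lfloor (x+y)/2\rfloor)$$ for all $x,y\in\mathbb{Z}^n$ with $\|x-y\|_\infty\ge2$. With $\operatorname{dom} f=\{x\in\mathbb{Z}^n\mid f(x)<+\infty\}$, the combination $g=a_1f_1+a_2f_2$ is understood to have $\operatorname{dom} g=\operatorname{dom} f_1\cap\operatorname{dom} f_2$. *)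

theory Defs
  imports "HOL-Analysis.Analysis"
begin

definition real_vec :: "int ^ 'n \<Rightarrow> real ^ 'n" where
  "real_vec x = (\<chi> i. real_of_int (x $ i))"

definition ceiling_vec :: "real ^ 'n \<Rightarrow> int ^ 'n" where
  "ceiling_vec v = (\<chi> i. \<lceil>v $ i\<rceil>)"

definition floor_vec :: "real ^ 'n \<Rightarrow> int ^ 'n" where
  "floor_vec v = (\<chi> i. \<lfloor>v $ i\<rfloor>)"

(* The exact midpoint (x + y)/2, a point of R^n. *)
definition mid :: "int ^ 'n \<Rightarrow> int ^ 'n \<Rightarrow> real ^ 'n" where
  "mid x y = (1/2) *\<^sub>R (real_vec x + real_vec y)"

(* Functions into R \<union> {+\<infinity>} are ereal-valued functions that avoid -\<infinity>;
   this requirement on the codomain is part of the definition. *)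
definition globally_dmc :: "(int ^ 'n \<Rightarrow> ereal) \<Rightarrow> bool" where
  "globally_dmc f \<longleftrightarrow>
     (\<forall>x. f x \<noteq> -\<infinity>) \<and>
     (\<forall>x y. infnorm (real_vec x - real_vec y) \<ge> 2 \<longrightarrow>
        f x + f y \<ge> f (ceiling_vec (mid x y)) + f (floor_vec (mid x y)))"

definition edom :: "(int ^ 'n \<Rightarrow> ereal) \<Rightarrow> (int ^ 'n) set" where
  "edom f = {x. f x < \<infinity>}"

(* a1 f1 + a2 f2 with effective domain dom f1 \<inter> dom f2 also when a1 = 0 or a2 = 0.
   The case distinction is needed since 0 * \<infinity> = 0 in ereal. *)
definition lincomb ::
  "real \<Rightarrow> (int ^ 'n \<Rightarrow> ereal) \<Rightarrow> real \<Rightarrow> (int ^ 'n \<Rightarrow> ereal) \<Rightarrow> int ^ 'n \<Rightarrow> ereal" where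
  "lincomb a1 f1 a2 f2 x =
     (if x \<in> edom f1 \<inter> edom f2 then ereal a1 * f1 x + ereal a2 * f2 x else \<infinity>)"

(* The library's convex_cone requires a real vector space, which extended-real-valued
   functions do not form. *)
definition function_convex_cone :: "(int ^ 'n \<Rightarrow> ereal) set \<Rightarrow> bool" where
  "function_convex_cone S \<longleftrightarrow> S \<noteq> {} \<and>
     (\<forall>a1 a2. \<forall>f1\<in>S. \<forall>f2\<in>S. a1 \<ge> 0 \<longrightarrow> a2 \<ge> 0 \<longrightarrow> lincomb a1 f1 a2 f2 \<in> S)"

end

theory Submission
  imports Defs
begin

text \<open>
  Translations, coordinate permutations and the reflection in the origin are isometries of
  \<open>\<int>\<^sup>n\<close> for the maximum norm, so they respect the condition that two points be at distance
  at least 2. They permute the coordinates, shift them by integers or change their sign, so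
  they carry the rounded midpoints of two points to the rounded midpoints of the images;
  sign changes interchange rounding up and rounding down, which the inequality does not
  see. All three closure properties are thus instances of \<open>globally_dmc_comp\<close>.

  For a nonnegative combination (\<open>globally_dmc_lincomb\<close>) the two inequalities can be scaled and
  added as soon as all values are finite. If \<open>x\<close> or \<open>y\<close> lies outside the common effective domain,
  the larger side is \<open>\<infinity>\<close>; otherwise \<open>edom_rounded_midpoints\<close> shows that the rounded midpoints
  lie in the common effective domain as well. A zero coefficient leaves this necessary, since
  the combination is \<open>\<infinity>\<close> outside that domain whatever the coefficients are.
\<close>

lemma globally_dmc_not_MInf: "globally_dmc f \<Longrightarrow> f x \<noteq> -\<infinity>"
  by (simp add: globally_dmc_def)

lemma globally_dmcD:
  "globally_dmc f \<Longrightarrow> infnorm (real_vec x - real_vec y) \<ge> 2 \<Longrightarrow>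
    f (ceiling_vec (mid x y)) + f (floor_vec (mid x y)) \<le> f x + f y"
  by (simp add: globally_dmc_def)

text \<open>
  The inequality is symmetric in the two rounded midpoints, so it is enough that the
  substitution preserves them as an unordered pair. The second alternative serves
  order-reversing substitutions, which exchange rounding up and rounding down.
\<close>

lemma globally_dmc_comp:
  fixes f :: "int ^ 'm \<Rightarrow> ereal" and T :: "int ^ 'n \<Rightarrow> int ^ 'm"
  assumes f: "globally_dmc f"
    and isometry: "\<And>x y. infnorm (real_vec (T x) - real_vec (T y)) = infnorm (real_vec x - real_vec y)"
    and midpoints: "\<And>x y.
      ceiling_vec (mid (T x) (T y)) = T (ceiling_vec (mid x y)) \<and>
      floor_vec (mid (T x) (T y)) = T (floor_vec (mid x y)) \<or>
      ceiling_vec (mid (T x) (T y)) = T (floor_vec (mid x y)) \<and>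
      floor_vec (mid (T x) (T y)) = T (ceiling_vec (mid x y))"
  shows "globally_dmc (\<lambda>x. f (T x))"
  unfolding globally_dmc_def
proof (intro conjI allI impI)
  fix x y :: "int ^ 'n"
  show "f (T x) \<noteq> -\<infinity>"
    using f by (rule globally_dmc_not_MInf)
  assume "infnorm (real_vec x - real_vec y) \<ge> 2"
  then have "f (ceiling_vec (mid (T x) (T y))) + f (floor_vec (mid (T x) (T y))) \<le> f (T x) + f (T y)"
    by (intro globally_dmcD[OF f]) (simp add: isometry)
  then show "f (T (ceiling_vec (mid x y))) + f (T (floor_vec (mid x y))) \<le> f (T x) + f (T y)"
    using midpoints[of x y] by (auto simp: add.commute)
qed

lemma globally_dmc_translation:
  assumes "globally_dmc f"
  shows "globally_dmc (\<lambda>x. f (z + x))"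
proof (rule globally_dmc_comp[OF assms])
  fix x y
  show "infnorm (real_vec (z + x) - real_vec (z + y)) = infnorm (real_vec x - real_vec y)"
    by (rule arg_cong[of _ _ infnorm]) (simp add: vec_eq_iff real_vec_def)
  \<comment> \<open>The midpoint moves by the integer vector \<open>z\<close>, past which rounding commutes.\<close>
  have "mid (z + x) (z + y) $ i = mid x y $ i + of_int (z $ i)" for i
    by (simp add: mid_def real_vec_def field_simps)
  then show "ceiling_vec (mid (z + x) (z + y)) = z + ceiling_vec (mid x y) \<and>
      floor_vec (mid (z + x) (z + y)) = z + floor_vec (mid x y) \<or>
      ceiling_vec (mid (z + x) (z + y)) = z + floor_vec (mid x y) \<and>
      floor_vec (mid (z + x) (z + y)) = z + ceiling_vec (mid x y)"
    by (simp add: vec_eq_iff ceiling_vec_def floor_vec_def)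
qed

lemma infnorm_permute:
  fixes v :: "real ^ 'n"
  assumes "\<sigma> permutes (UNIV :: 'n set)"
  shows "infnorm (\<chi> i. v $ \<sigma> i) = infnorm v"
proof -
  have "{\<bar>v $ \<sigma> i\<bar> |i. i \<in> UNIV} = {\<bar>v $ i\<bar> |i. i \<in> UNIV}"
    using permutes_surj[OF assms] by (auto simp: surj_def) metis
  then show ?thesis
    by (simp add: infnorm_cart)
qed

lemma globally_dmc_permute:
  fixes f :: "int ^ 'n \<Rightarrow> ereal"
  assumes "globally_dmc f" and "\<sigma> permutes (UNIV :: 'n set)"
  shows "globally_dmc (\<lambda>x. f (\<chi> i. x $ \<sigma> i))"
proof (rule globally_dmc_comp[OF assms(1)])
  fix x y :: "int ^ 'n"
  let ?P = "\<lambda>x :: int ^ 'n. \<chi> i. x $ \<sigma> i"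
  have "real_vec (?P x) - real_vec (?P y) = (\<chi> i. (real_vec x - real_vec y) $ \<sigma> i)"
    by (simp add: vec_eq_iff real_vec_def)
  then show "infnorm (real_vec (?P x) - real_vec (?P y)) = infnorm (real_vec x - real_vec y)"
    by (simp only: infnorm_permute[OF assms(2)])
  show "ceiling_vec (mid (?P x) (?P y)) = ?P (ceiling_vec (mid x y)) \<and>
      floor_vec (mid (?P x) (?P y)) = ?P (floor_vec (mid x y)) \<or>
      ceiling_vec (mid (?P x) (?P y)) = ?P (floor_vec (mid x y)) \<and>
      floor_vec (mid (?P x) (?P y)) = ?P (ceiling_vec (mid x y))"
    by (simp add: vec_eq_iff ceiling_vec_def floor_vec_def mid_def real_vec_def)
qed

lemma globally_dmc_reflection:
  assumes "globally_dmc f"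
  shows "globally_dmc (\<lambda>x. f (\<chi> i. - (x $ i)))"
proof (rule globally_dmc_comp[OF assms])
  fix x y :: "int ^ 'a"
  let ?N = "\<lambda>x :: int ^ 'a. \<chi> i. - (x $ i)"
  have "real_vec (?N x) - real_vec (?N y) = - (real_vec x - real_vec y)"
    by (simp add: vec_eq_iff real_vec_def)
  then show "infnorm (real_vec (?N x) - real_vec (?N y)) = infnorm (real_vec x - real_vec y)"
    by (simp only: infnorm_neg)
  have "mid (?N x) (?N y) $ i = - (mid x y $ i)" for i
    by (simp add: mid_def real_vec_def field_simps)
  then show "ceiling_vec (mid (?N x) (?N y)) = ?N (ceiling_vec (mid x y)) \<and>
      floor_vec (mid (?N x) (?N y)) = ?N (floor_vec (mid x y)) \<or>
      ceiling_vec (mid (?N x) (?N y)) = ?N (floor_vec (mid x y)) \<and>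
      floor_vec (mid (?N x) (?N y)) = ?N (ceiling_vec (mid x y))"
    by (simp add: vec_eq_iff ceiling_vec_def floor_vec_def ceiling_minus floor_minus)
qed

text \<open>
  Effective domains are closed under rounded midpoints of distant points, because a finite
  right-hand side forces both terms on the left, neither of which is \<open>-\<infinity>\<close>, to be finite.
\<close>

lemma edom_rounded_midpoints:
  assumes f: "globally_dmc f" and far: "infnorm (real_vec x - real_vec y) \<ge> 2"
    and dom: "x \<in> edom f" "y \<in> edom f"
  shows "ceiling_vec (mid x y) \<in> edom f" and "floor_vec (mid x y) \<in> edom f"
proof -
  have "f x + f y < \<infinity>"
    using dom by (simp add: edom_def)
  then have "f (ceiling_vec (mid x y)) + f (floor_vec (mid x y)) < \<infinity>"
    using globally_dmcD[OF f far] by (rule le_less_trans[rotated])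
  then show "ceiling_vec (mid x y) \<in> edom f" and "floor_vec (mid x y) \<in> edom f"
    by (simp_all add: edom_def)
qed

lemma globally_dmc_finite_on_edom:
  assumes "globally_dmc f" and "x \<in> edom f"
  obtains r where "f x = ereal r"
  using assms globally_dmc_not_MInf[of f x] by (cases "f x") (auto simp: edom_def)

lemma globally_dmc_lincomb:
  assumes "a1 \<ge> 0" "a2 \<ge> 0" and f1: "globally_dmc f1" and f2: "globally_dmc f2"
  shows "globally_dmc (lincomb a1 f1 a2 f2)"
  unfolding globally_dmc_def
proof (intro conjI allI impI)
  fix x y
  let ?g = "lincomb a1 f1 a2 f2"
  show "?g x \<noteq> -\<infinity>"
  proof (cases "x \<in> edom f1 \<inter> edom f2")
    case True
    obtain r where "f1 x = ereal r"
      using globally_dmc_finite_on_edom[OF f1, of x] True by blast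
    moreover obtain s where "f2 x = ereal s"
      using globally_dmc_finite_on_edom[OF f2, of x] True by blast
    ultimately show ?thesis
      using True by (simp add: lincomb_def)
  qed (auto simp: lincomb_def)
  assume far: "infnorm (real_vec x - real_vec y) \<ge> 2"
  let ?u = "ceiling_vec (mid x y)" and ?v = "floor_vec (mid x y)"
  show "?g ?u + ?g ?v \<le> ?g x + ?g y"
  proof (cases "x \<in> edom f1 \<inter> edom f2 \<and> y \<in> edom f1 \<inter> edom f2")
    case False
    then have "?g x = \<infinity> \<or> ?g y = \<infinity>"
      by (auto simp: lincomb_def)
    then show ?thesis
      by auto
  next
    case True
    then have uv: "?u \<in> edom f1 \<inter> edom f2" "?v \<in> edom f1 \<inter> edom f2"
      using edom_rounded_midpoints[OF f1 far] edom_rounded_midpoints[OF f2 far] by auto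
    \<comment> \<open>All eight values are finite, which reduces the claim to arithmetic of reals.\<close>
    obtain x1 y1 u1 v1 where 1: "f1 x = ereal x1" "f1 y = ereal y1" "f1 ?u = ereal u1" "f1 ?v = ereal v1"
      using globally_dmc_finite_on_edom[OF f1] True uv by (metis IntD1)
    obtain x2 y2 u2 v2 where 2: "f2 x = ereal x2" "f2 y = ereal y2" "f2 ?u = ereal u2" "f2 ?v = ereal v2"
      using globally_dmc_finite_on_edom[OF f2] True uv by (metis IntD2)
    have "u1 + v1 \<le> x1 + y1" "u2 + v2 \<le> x2 + y2"
      using globally_dmcD[OF f1 far] globally_dmcD[OF f2 far] by (simp_all add: 1 2)
    then have "a1 * (u1 + v1) + a2 * (u2 + v2) \<le> a1 * (x1 + y1) + a2 * (x2 + y2)"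
      using assms(1,2) by (intro add_mono[of "a1 * (u1 + v1)"] mult_left_mono)
    then show ?thesis
      using True uv by (simp add: lincomb_def 1 2 algebra_simps)
  qed
qed

theorem proposition2p13:
  fixes f :: "int ^ 'n \<Rightarrow> ereal"
  assumes "globally_dmc f"
  shows "(\<forall>z. globally_dmc (\<lambda>x. f (z + x)))
    \<and> (\<forall>\<sigma>. \<sigma> permutes (UNIV :: 'n set) \<longrightarrow> globally_dmc (\<lambda>x. f (\<chi> i. x $ \<sigma> i)))
    \<and> globally_dmc (\<lambda>x. f (\<chi> i. - (x $ i)))
    \<and> (\<forall>a1 a2 :: real. \<forall>f1 f2 :: int ^ 'n \<Rightarrow> ereal.
          a1 \<ge> 0 \<longrightarrow> a2 \<ge> 0 \<longrightarrow> globally_dmc f1 \<longrightarrow> globally_dmc f2 \<longrightarrow>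
          globally_dmc (lincomb a1 f1 a2 f2))
    \<and> function_convex_cone {h :: int ^ 'n \<Rightarrow> ereal. globally_dmc h}"
proof -
  have "function_convex_cone {h :: int ^ 'n \<Rightarrow> ereal. globally_dmc h}"
    unfolding function_convex_cone_def using assms by (blast intro: globally_dmc_lincomb)
  then show ?thesis
    using globally_dmc_translation[OF assms] globally_dmc_permute[OF assms]
      globally_dmc_reflection[OF assms] globally_dmc_lincomb by blast
qed

end
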